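(* Let $\mathcal{B}$ be a Bayesian belief network whose nodes are the variables of a system, the system being described by its structural model $\mathcal{M}$ (a self-contained set of structural equations in these variables). Then $\mathcal{B}$ reflects the causal structure of the system if and only if both of the following hold: (1) each node of $\mathcal{B}$ and all its direct predecessors describe variables involved in a separate mechanism in the system; that is, there is an injective map $v\mapsto e_v$ from the nodes of $\mathcal{B}$ to the equations of $\mathcal{M}$ such that, for every node $v$, the set of variables occurring in $e_v$ is exactly the set consisting of $v$ and all direct predecessors of $v$ in $\mathcal{B}$; and (2) each node of $\mathcal{B}$ with no predecessors represents an exogenous variable of the system.
   Context: A Bayesian belief network $\mathcal{B}$ consists of a finite directed acyclic graph whose nodes are random variables, together with a conditional probability distribution of each node given its direct predecessors (parents); only the graph matters here. A structural model $\mathcal{M}$ of a system is a self-contained set of equations, each of the form $f(x_1,\dots,x_r,\mathcal{E})=0$, where $x_1,\dots,x_r$ are the system variables occurring in the equation and $\mathcal{E}$ is an error variable (not counted among the variables). Each equation is structural: it describes one conceptually distinct mechanism of the system, and a variable occurs in the equation if and only if it directly participates in that mechanism. Distinct equations correspond to distinct (separate) mechanisms. A variable is exogenous if its value is determined outside the system, which is expressed in $\mathcal{M}$ by an equation in which it is the only variable occurring (apart from the error variable). A finite set of equations is self-contained if it has as many equations as variables and, for every $m$, each of its subsets consisting of $m$ equations contains at least $m$ variables. A self-contained subset consisting of $k$ equations with $k$ variables has degree $k$. A (nonempty) self-contained subset is minimal if it has no nonempty proper self-contained subset. Causal ordering over a self-contained set of equations is obtained by the following recursive procedure. At step $0$,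 identify all minimal self-contained subsets. Solve each of them for the variables it contains, remove its equations, and substitute the obtained values for those variables in the remaining equations (so that these variables no longer count as variables of the remaining equations). At step $k=1,2,\dots$, do the same with the remaining equations in the remaining (not yet determined) variables. Stop when no equations remain. The variables that occur in the original equations of a subset identified at step $k$ but were determined at an earlier step are the direct causal predecessors of the variables determined by that subset. The causal graph has one node for each variable and a directed arc to each variable from each of its direct causal predecessors. The causal graph is called acyclic if every minimal self-contained subset identified at any step of the procedure has degree one (consists of a single equation). The causal structure of the system is the causal graph obtained by causal ordering from its structural model $\mathcal{M}$. $\mathcal{B}$ reflects the causal structure of the system if this causal graph is acyclic in the sense just defined and coincides with the directed graph of $\mathcal{B}$ (same nodes, same arcs). *)

theory Defs
  imports "Graph_Theory.Pair_Digraph"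
begin

text \<open>
  Causal ordering depends only on which variables occur in which equation, so an equation is an
  element of an arbitrary type and \<open>occ\<close> gives the variables occurring in it.  The error variable
  is not a variable and is not listed by \<open>occ\<close>.
\<close>

record ('e, 'v) equation_system =
  eqs :: "'e set"
  occ :: "'e \<Rightarrow> 'v set"

definition vars_of :: "('e, 'v, 'x) equation_system_scheme \<Rightarrow> 'e set \<Rightarrow> 'v set" where
  "vars_of M S = (\<Union>e\<in>S. occ M e)"

definition self_contained :: "('e, 'v, 'x) equation_system_scheme \<Rightarrow> 'e set \<Rightarrow> bool" where
  "self_contained M S \<longleftrightarrow>
     finite S \<and> finite (vars_of M S) \<and> card S = card (vars_of M S) \<and>
     (\<forall>T\<subseteq>S. card T \<le> card (vars_of M T))"

definition structural_model :: "('e, 'v) equation_system \<Rightarrow> bool" where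
  "structural_model M \<longleftrightarrow> self_contained M (eqs M)"

definition exogenous :: "('e, 'v) equation_system \<Rightarrow> 'v \<Rightarrow> bool" where
  "exogenous M v \<longleftrightarrow> (\<exists>e\<in>eqs M. occ M e = {v})"

definition minimal_subsets :: "('e, 'v) equation_system \<Rightarrow> 'e set set" where
  "minimal_subsets M =
     {S. S \<subseteq> eqs M \<and> S \<noteq> {} \<and> self_contained M S \<and>
         (\<forall>T. T \<subset> S \<and> T \<noteq> {} \<longrightarrow> \<not> self_contained M T)}"

text \<open>
  \<open>residual M k\<close> is the system at the start of step \<open>k\<close>.  Solving and substituting makes the
  variables of the identified subsets cease to occur in the remaining equations.  Once no equations
  remain, all later steps identify nothing, so no explicit stopping condition is needed.
\<close>

definition solve_minimal :: "('e, 'v) equation_system \<Rightarrow> ('e, 'v) equation_system" where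
  "solve_minimal M =
     \<lparr> eqs = eqs M - \<Union>(minimal_subsets M),
       occ = (\<lambda>e. occ M e - vars_of M (\<Union>(minimal_subsets M))) \<rparr>"

primrec residual :: "('e, 'v) equation_system \<Rightarrow> nat \<Rightarrow> ('e, 'v) equation_system" where
  "residual M 0 = M"
| "residual M (Suc k) = solve_minimal (residual M k)"

definition identified :: "('e, 'v) equation_system \<Rightarrow> nat \<Rightarrow> 'e set set" where
  "identified M k = minimal_subsets (residual M k)"

definition determined_by :: "('e, 'v) equation_system \<Rightarrow> nat \<Rightarrow> 'e set \<Rightarrow> 'v set" where
  "determined_by M k S = vars_of (residual M k) S"

definition determined_before :: "('e, 'v) equation_system \<Rightarrow> nat \<Rightarrow> 'v set" where
  "determined_before M k = (\<Union>j<k. \<Union>S\<in>identified M j. determined_by M j S)"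

definition causal_predecessors :: "('e, 'v) equation_system \<Rightarrow> nat \<Rightarrow> 'e set \<Rightarrow> 'v set" where
  "causal_predecessors M k S = vars_of M S \<inter> determined_before M k"

definition causal_graph :: "('e, 'v) equation_system \<Rightarrow> 'v pair_pre_digraph" where
  "causal_graph M =
     \<lparr> pverts = vars_of M (eqs M),
       parcs = {(u, v). \<exists>k. \<exists>S\<in>identified M k.
                  u \<in> causal_predecessors M k S \<and> v \<in> determined_by M k S} \<rparr>"

text \<open>
  Acyclicity of the causal graph is a property of the ordering procedure, not of the arcs alone:
  the variables of a subset of degree greater than one are not joined by arcs to each other.
\<close>

definition causally_acyclic :: "('e, 'v) equation_system \<Rightarrow> bool" where
  "causally_acyclic M \<longleftrightarrow> (\<forall>k. \<forall>S\<in>identified M k. card S = 1)"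

text \<open>
  A belief network enters only through its graph; the conditional distributions are left out.
\<close>

definition belief_network_graph :: "'v pair_pre_digraph \<Rightarrow> bool" where
  "belief_network_graph B \<longleftrightarrow> pair_fin_digraph B \<and> acyclic (parcs B)"

definition direct_predecessors :: "'v pair_pre_digraph \<Rightarrow> 'v \<Rightarrow> 'v set" where
  "direct_predecessors B v = {u. (u, v) \<in> parcs B}"

definition reflects_causal_structure ::
  "'v pair_pre_digraph \<Rightarrow> ('e, 'v) equation_system \<Rightarrow> bool" where
  "reflects_causal_structure B M \<longleftrightarrow> causally_acyclic M \<and> causal_graph M = B"

end

theory Submission
  imports Defs
begin

text \<open>
  The Hall condition makes the number of variables minus the number of equations a nonnegative
  submodular function vanishing exactly on self-contained subsets.  Hence self-contained subsets
  are closed under union, every residual system is again self-contained, and the procedure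
  exhausts all equations.  If all identified subsets are singletons, each variable is determined by
  exactly one equation, which contains, besides that variable, precisely its causal predecessors.
  Conversely, if equations are matched to variables along an acyclic graph, a minimal subset
  contains the equation of a source among its variables, and this equation alone is self-contained.
\<close>

section \<open>Closure properties of self-contained subsets\<close>

lemma vars_of_Un: "vars_of M (S \<union> T) = vars_of M S \<union> vars_of M T"
  by (auto simp: vars_of_def)

lemma vars_of_mono: "S \<subseteq> T \<Longrightarrow> vars_of M S \<subseteq> vars_of M T"
  by (auto simp: vars_of_def)

lemma vars_of_singleton [simp]: "vars_of M {e} = occ M e"
  by (simp add: vars_of_def)

text \<open>Finiteness and the Hall inequalities pass down to subsets, so only the upper bound on
  the number of variables remains to be checked.\<close>

lemma self_contained_subsetI:
  assumes "self_contained M E" "S \<subseteq> E" "card (vars_of M S) \<le> card S"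
  shows "self_contained M S"
  using assms vars_of_mono[OF assms(2), of M]
  unfolding self_contained_def by (metis finite_subset le_antisym subset_trans)

text \<open>Inclusion-exclusion for equations and for variables, combined with the Hall inequality
  for \<open>S \<inter> T\<close>, whose variables lie in both variable sets.\<close>

lemma self_contained_Un:
  assumes E: "self_contained M E" and "S \<subseteq> E" "T \<subseteq> E"
    and S: "self_contained M S" and T: "self_contained M T"
  shows "self_contained M (S \<union> T)"
proof (rule self_contained_subsetI[OF E])
  show "S \<union> T \<subseteq> E" using assms by blast
  have fin: "finite S" "finite T" "finite (vars_of M S)" "finite (vars_of M T)"
    and eq: "card S = card (vars_of M S)" "card T = card (vars_of M T)"
    using S T by (auto simp: self_contained_def)
  have "card (S \<inter> T) \<le> card (vars_of M (S \<inter> T))"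
    using S unfolding self_contained_def by blast
  also have "\<dots> \<le> card (vars_of M S \<inter> vars_of M T)"
    using fin by (intro card_mono) (auto simp: vars_of_def)
  finally show "card (vars_of M (S \<union> T)) \<le> card (S \<union> T)"
    using card_Un_Int[OF fin(1,2)] card_Un_Int[OF fin(3,4)] eq
    by (simp add: vars_of_Un)
qed

lemma self_contained_Union:
  assumes E: "self_contained M E" and "\<And>S. S \<in> F \<Longrightarrow> S \<subseteq> E \<and> self_contained M S"
  shows "self_contained M (\<Union>F)"
proof -
  have "finite (Pow E)" using E by (simp add: self_contained_def)
  then have "finite F" by (rule rev_finite_subset) (use assms in blast)
  then show ?thesis using assms(2)
  proof (induction F rule: finite_induct)
    case empty
    then show ?case by (simp add: self_contained_def vars_of_def)
  next
    case (insert S F)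
    have "\<Union>F \<subseteq> E" using insert.prems by blast
    then show ?case
      using self_contained_Un[OF E] insert by simp
  qed
qed

section \<open>Residual systems and progress of the procedure\<close>

text \<open>The solved part \<open>U\<close> uses up exactly \<open>card U\<close> variables, so
  subtracting \<open>card U\<close> from the Hall inequality for \<open>T \<union> U\<close> leaves
  the one for \<open>T\<close>.\<close>

lemma self_contained_solve_minimal:
  assumes M: "self_contained M (eqs M)"
  shows "self_contained (solve_minimal M) (eqs (solve_minimal M))"
proof -
  define U where "U = \<Union>(minimal_subsets M)"
  let ?N = "solve_minimal M"
  have UE: "U \<subseteq> eqs M" by (auto simp: U_def minimal_subsets_def)
  have U: "self_contained M U" unfolding U_def
    by (rule self_contained_Union[OF M]) (auto simp: minimal_subsets_def)
  have eqs: "eqs ?N = eqs M - U" by (simp add: solve_minimal_def U_def)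
  \<comment> \<open>Adding \<open>U\<close> to \<open>T\<close> makes this a difference of nested
    sets, so cardinalities can be subtracted.\<close>
  have vars: "vars_of ?N T = vars_of M (T \<union> U) - vars_of M U" for T
    by (auto simp: solve_minimal_def U_def vars_of_def)
  have fin: "finite (eqs M)" "finite (vars_of M (eqs M))"
    using M by (auto simp: self_contained_def)
  have card_vars: "card (vars_of ?N T) = card (vars_of M (T \<union> U)) - card U" for T
    using U vars[of T] vars_of_mono[of U "T \<union> U" M]
    by (simp add: card_Diff_subset self_contained_def)
  have "card T \<le> card (vars_of ?N T)" if "T \<subseteq> eqs M - U" for T
  proof -
    have "card (T \<union> U) \<le> card (vars_of M (T \<union> U))"
      using M UE that unfolding self_contained_def by blast
    moreover have "card (T \<union> U) = card T + card U"
      using that UE fin by (intro card_Un_disjoint) (auto intro: finite_subset)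
    ultimately show ?thesis by (simp add: card_vars)
  qed
  moreover have "card (eqs M - U) = card (vars_of ?N (eqs M - U))"
  proof -
    have "eqs M - U \<union> U = eqs M" using UE by blast
    moreover have "card (eqs M - U) = card (eqs M) - card U"
      using UE fin by (intro card_Diff_subset) (auto intro: finite_subset)
    ultimately show ?thesis using M by (simp add: card_vars self_contained_def)
  qed
  moreover have "finite (vars_of ?N (eqs M - U))"
    using fin vars_of_mono[of "eqs M - U \<union> U" "eqs M" M] UE
    unfolding vars by (intro finite_Diff) (auto intro: finite_subset)
  ultimately show ?thesis
    using fin unfolding self_contained_def eqs by auto
qed

lemma self_contained_residual:
  assumes "structural_model M"
  shows "self_contained (residual M k) (eqs (residual M k))"
  using assms by (induction k) (auto simp: structural_model_def self_contained_solve_minimal)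

lemma eqs_residual: "eqs (residual M k) = eqs M - (\<Union>j<k. \<Union>(identified M j))"
  by (induction k) (auto simp: solve_minimal_def identified_def lessThan_Suc)

text \<open>Closed form of the iterated substitution: it relates occurrences at step
  \<open>k\<close> to the original equations, in which causal predecessors are read off.\<close>

lemma occ_residual: "occ (residual M k) e = occ M e - determined_before M k"
proof (induction k)
  case 0
  then show ?case by (simp add: determined_before_def)
next
  case (Suc k)
  have "determined_before M (Suc k) =
      determined_before M k \<union> vars_of (residual M k) (\<Union>(identified M k))"
    by (auto simp: determined_before_def determined_by_def vars_of_def lessThan_Suc)
  then show ?case using Suc by (auto simp: solve_minimal_def identified_def)
qed

lemma minimal_subsets_nonempty:
  assumes M: "self_contained M (eqs M)" and "eqs M \<noteq> {}"
  shows "minimal_subsets M \<noteq> {}"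
proof -
  let ?F = "{S. S \<subseteq> eqs M \<and> S \<noteq> {} \<and> self_contained M S}"
  have "finite (eqs M)" using M by (simp add: self_contained_def)
  then have "finite ?F" by (auto intro: finite_subset[of _ "Pow (eqs M)"])
  moreover have "eqs M \<in> ?F" using assms by simp
  ultimately obtain S where "S \<in> ?F" "\<And>T. T \<in> ?F \<Longrightarrow> T \<subseteq> S \<Longrightarrow> S = T"
    by (metis (no_types, lifting) empty_iff finite_has_minimal)
  then have "S \<in> minimal_subsets M" unfolding minimal_subsets_def by blast
  then show ?thesis by blast
qed

lemma identified_subset: "S \<in> identified M k \<Longrightarrow> S \<subseteq> eqs (residual M k)"
  by (simp add: identified_def minimal_subsets_def)

lemma identified_self_contained: "S \<in> identified M k \<Longrightarrow> self_contained (residual M k) S"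
  by (simp add: identified_def minimal_subsets_def)

text \<open>A nonempty residual has a minimal subset, so every step removes an equation until none
  is left.\<close>

lemma every_equation_identified:
  assumes M: "structural_model M" and e: "e \<in> eqs M"
  obtains k S where "S \<in> identified M k" "e \<in> S"
proof -
  have fin: "finite (eqs (residual M k))" for k
    using self_contained_residual[OF M] by (simp add: self_contained_def)
  \<comment> \<open>The numerical bound alone fails for large \<open>k\<close>, once the residual is
    empty; hence the disjunction.\<close>
  have "eqs (residual M k) = {} \<or> card (eqs (residual M k)) + k \<le> card (eqs M)" for k
  proof (induction k)
    case (Suc k)
    show ?case
    proof (cases "eqs (residual M k) = {}")
      case True
      then show ?thesis by (simp add: solve_minimal_def)
    next
      case False
      then obtain S where "S \<in> minimal_subsets (residual M k)"
        using minimal_subsets_nonempty[OF self_contained_residual[OF M]] by blast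
      then have "eqs (residual M (Suc k)) \<subset> eqs (residual M k)"
        by (auto simp: solve_minimal_def minimal_subsets_def)
      then have "card (eqs (residual M (Suc k))) < card (eqs (residual M k))"
        using fin by (intro psubset_card_mono)
      then show ?thesis using Suc False by simp
    qed
  qed simp
  from this[of "Suc (card (eqs M))"] have "eqs (residual M (Suc (card (eqs M)))) = {}" by simp
  then show ?thesis using e that unfolding eqs_residual by blast
qed

text \<open>An identified equation is removed from all later residuals.\<close>

lemma identified_step_unique:
  assumes "S \<in> identified M j" "e \<in> S" "T \<in> identified M k" "e \<in> T"
  shows "j = k"
proof -
  have "\<not> i < l" if "S \<in> identified M i" "e \<in> S" "T \<in> identified M l" "e \<in> T" for i l S T
    using identified_subset[OF that(3)] that by (auto simp: eqs_residual)
  then show ?thesis using assms by (metis nat_neq_iff)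
qed

lemma determined_step_unique:
  assumes "S \<in> identified M j" "v \<in> determined_by M j S"
    and "T \<in> identified M k" "v \<in> determined_by M k T"
  shows "j = k"
proof -
  have "\<not> i < l" if "S \<in> identified M i" "v \<in> determined_by M i S" "v \<in> determined_by M l T"
    for i l S T
    using that by (auto simp: determined_by_def[of M l] vars_of_def occ_residual determined_before_def)
  then show ?thesis using assms by (metis nat_neq_iff)
qed

text \<open>When an equation containing \<open>v\<close> is identified, \<open>v\<close> either was
  determined earlier or still occurs in it and is determined now.\<close>

lemma every_variable_determined:
  assumes "structural_model M" "v \<in> vars_of M (eqs M)"
  obtains k S where "S \<in> identified M k" "v \<in> determined_by M k S"
proof -
  obtain e where e: "e \<in> eqs M" "v \<in> occ M e" using assms(2) by (auto simp: vars_of_def)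
  obtain k S where S: "S \<in> identified M k" "e \<in> S"
    using every_equation_identified[OF assms(1) e(1)] .
  show ?thesis
  proof (cases "v \<in> determined_before M k")
    case True
    then show ?thesis using that by (auto simp: determined_before_def)
  next
    case False
    then have "v \<in> determined_by M k S"
      using e S by (auto simp: determined_by_def vars_of_def occ_residual)
    then show ?thesis using S that by blast
  qed
qed

section \<open>From an acyclic causal ordering to a matching\<close>

lemma causally_acyclic_determined:
  assumes "causally_acyclic M" "S \<in> identified M k" "v \<in> determined_by M k S"
  obtains e where "S = {e}" "occ (residual M k) e = {v}"
proof -
  obtain e where e: "S = {e}"
    using assms(1,2) unfolding causally_acyclic_def by (metis card_1_singletonE)
  then have "card (occ (residual M k) e) = 1"
    using identified_self_contained[OF assms(2)] by (simp add: self_contained_def)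
  then have "occ (residual M k) e = {v}"
    using assms(3) e by (auto simp: determined_by_def card_1_singleton_iff)
  then show ?thesis using e that by blast
qed

text \<open>The equation matched to \<open>v\<close> is the one that determines \<open>v\<close>:
  all its other variables were determined earlier, and these are the direct causal
  predecessors.\<close>

lemma causally_acyclic_eq_of:
  assumes M: "structural_model M" and acyc: "causally_acyclic M"
  obtains eq_of where "inj_on eq_of (vars_of M (eqs M))" "eq_of ` vars_of M (eqs M) \<subseteq> eqs M"
    "\<And>v. v \<in> vars_of M (eqs M) \<Longrightarrow>
      occ M (eq_of v) = insert v (direct_predecessors (causal_graph M) v)"
proof -
  have "\<exists>e k. {e} \<in> identified M k \<and> occ (residual M k) e = {v}" if "v \<in> vars_of M (eqs M)" for v
    by (metis M acyc that every_variable_determined causally_acyclic_determined)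
  then obtain f step where f:
    "\<And>v. v \<in> vars_of M (eqs M) \<Longrightarrow>
      {f v} \<in> identified M (step v) \<and> occ (residual M (step v)) (f v) = {v}"
    by metis
  have inj: "inj_on f (vars_of M (eqs M))"
  proof (rule inj_onI)
    fix v w assume vw: "v \<in> vars_of M (eqs M)" "w \<in> vars_of M (eqs M)" "f v = f w"
    \<comment> \<open>Equal steps put the shared equation into one residual system, where its only
      remaining variable is both \<open>v\<close> and \<open>w\<close>.\<close>
    then have "step v = step w" by (metis f identified_step_unique insertI1)
    then show "v = w" using f[OF vw(1)] f[OF vw(2)] vw(3) by (metis singleton_inject)
  qed
  have sub: "f ` vars_of M (eqs M) \<subseteq> eqs M"
    using f identified_subset eqs_residual by fastforce
  have occ: "occ M (f v) = insert v (direct_predecessors (causal_graph M) v)"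
    if v: "v \<in> vars_of M (eqs M)" for v
  proof -
    have fv: "{f v} \<in> identified M (step v)" "occ (residual M (step v)) (f v) = {v}"
      using f[OF v] by auto
    \<comment> \<open>Arcs into \<open>v\<close> may come from any step and any subset determining
      \<open>v\<close>; uniqueness reduces them to those of \<open>f v\<close>.\<close>
    have uniq: "k = step v \<and> S = {f v}"
      if S: "S \<in> identified M k" "v \<in> determined_by M k S" for k S
    proof -
      have k: "k = step v"
        using determined_step_unique[OF S fv(1)] fv(2) by (simp add: determined_by_def)
      obtain e where e: "S = {e}" "occ (residual M k) e = {v}"
        using causally_acyclic_determined[OF acyc S] .
      \<comment> \<open>Two distinct equations in the single variable \<open>v\<close> would violate
        the Hall inequality.\<close>
      have "{e, f v} \<subseteq> eqs (residual M k)"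
        using identified_subset[OF fv(1)] identified_subset[OF S(1)] k e by auto
      then have "card {e, f v} \<le> card (vars_of (residual M k) {e, f v})"
        using self_contained_residual[OF M, of k] unfolding self_contained_def by blast
      also have "vars_of (residual M k) {e, f v} = {v}"
        using e fv(2) k by (simp add: vars_of_def)
      finally have "e = f v" by (cases "e = f v") auto
      then show ?thesis using k e by simp
    qed
    have "direct_predecessors (causal_graph M) v = causal_predecessors M (step v) {f v}"
      (is "?L = ?R")
    proof
      show "?L \<subseteq> ?R"
      proof
        fix u assume "u \<in> ?L"
        then obtain k S where "S \<in> identified M k" "u \<in> causal_predecessors M k S"
          "v \<in> determined_by M k S"
          by (auto simp: direct_predecessors_def causal_graph_def)
        then show "u \<in> ?R" using uniq by blast
      qed
      have "v \<in> determined_by M (step v) {f v}" using fv(2) by (simp add: determined_by_def)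
      then show "?R \<subseteq> ?L"
        using fv(1) by (auto simp: direct_predecessors_def causal_graph_def)
    qed
    then have "direct_predecessors (causal_graph M) v = occ M (f v) \<inter> determined_before M (step v)"
      by (simp add: causal_predecessors_def)
    then show ?thesis using fv(2) unfolding occ_residual by blast
  qed
  show ?thesis using that inj sub occ .
qed

section \<open>From a matching along an acyclic graph to the causal graph\<close>

lemma acyclic_finite_source:
  assumes "acyclic r" "finite W" "W \<noteq> {}"
  obtains w where "w \<in> W" "\<And>u. (u, w) \<in> r \<Longrightarrow> u \<notin> W"
proof -
  let ?r = "r \<inter> W \<times> W"
  have "finite ?r" using assms(2) by simp
  moreover have "acyclic ?r" using assms(1) by (rule acyclic_subset) blast
  ultimately have "wf ?r" by (rule finite_acyclic_wf)
  then obtain w where "w \<in> W" "\<And>u. (u, w) \<in> ?r \<Longrightarrow> u \<notin> W"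
    using assms(3) by (metis all_not_in_conv wfE_min)
  then show ?thesis using that by blast
qed

text \<open>Fixes a witness for the mechanism condition, together with the graph properties that a
  belief network supplies.\<close>

locale matched_model =
  fixes M :: "('e, 'v) equation_system" and B :: "'v pair_pre_digraph" and eq_of :: "'v \<Rightarrow> 'e"
  assumes model: "structural_model M"
    and acyclic_arcs: "acyclic (parcs B)"
    and verts: "pverts B = vars_of M (eqs M)"
    and arcs: "parcs B \<subseteq> pverts B \<times> pverts B"
    and inj: "inj_on eq_of (pverts B)"
    and eq_of_in: "eq_of ` pverts B \<subseteq> eqs M"
    and occ_eq_of: "v \<in> pverts B \<Longrightarrow> occ M (eq_of v) = insert v (direct_predecessors B v)"
begin

lemma finite_pverts: "finite (pverts B)"
  using model by (simp add: verts structural_model_def self_contained_def)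

text \<open>There are as many equations as variables, so the injective matching is onto.\<close>

lemma eqs_eq: "eqs M = eq_of ` pverts B"
proof (rule sym, rule card_subset_eq[OF _ eq_of_in])
  show "finite (eqs M)" using model by (simp add: structural_model_def self_contained_def)
  show "card (eq_of ` pverts B) = card (eqs M)"
    using model unfolding card_image[OF inj]
    by (simp add: verts structural_model_def self_contained_def)
qed

text \<open>The premise \<open>res\<close> is kept explicit because it is proved by induction on
  \<open>k\<close>, and the induction step uses this lemma.\<close>

lemma identified_singleton:
  assumes res: "eqs (residual M k) = eq_of ` (pverts B - determined_before M k)"
    and S: "S \<in> identified M k"
  obtains w where "w \<in> pverts B - determined_before M k" "S = {eq_of w}"
    "occ (residual M k) (eq_of w) = {w}"
    "direct_predecessors B w \<subseteq> determined_before M k"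
proof -
  let ?D = "determined_before M k"
  obtain W where W: "W \<subseteq> pverts B - ?D" "S = eq_of ` W"
    using identified_subset[OF S] unfolding res by (meson subset_imageE)
  have sc: "self_contained (residual M k) S" and ne: "S \<noteq> {}"
    and min: "\<And>T. T \<subset> S \<Longrightarrow> T \<noteq> {} \<Longrightarrow> \<not> self_contained (residual M k) T"
    using S by (auto simp: identified_def minimal_subsets_def)
  have finW: "finite W" using W finite_pverts by (auto intro: finite_subset)
  have occ: "occ (residual M k) (eq_of w) = insert w (direct_predecessors B w - ?D)"
    if "w \<in> W" for w
    using W that by (auto simp: occ_residual occ_eq_of)
  \<comment> \<open>Each matched equation contains its own variable, so \<open>S\<close> has at
    least the variables \<open>W\<close>; counting excludes any others. Hence \<open>W\<close> is
    closed under undetermined predecessors.\<close>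
  have "W = vars_of (residual M k) S"
  proof (rule card_subset_eq)
    show "finite (vars_of (residual M k) S)" using sc by (simp add: self_contained_def)
    show "W \<subseteq> vars_of (residual M k) S" using W occ by (auto simp: vars_of_def)
    have "card W = card S"
      unfolding W(2) using W(1) by (intro card_image[symmetric] inj_on_subset[OF inj]) blast
    then show "card W = card (vars_of (residual M k) S)"
      using sc by (simp add: self_contained_def)
  qed
  then have closed: "direct_predecessors B w - ?D \<subseteq> W" if "w \<in> W" for w
    using that W occ by (auto simp: vars_of_def)
  \<comment> \<open>A source of \<open>W\<close> has all its predecessors already determined, so its
    equation alone is self-contained and minimality makes it all of \<open>S\<close>.\<close>
  obtain w where w: "w \<in> W" "\<And>u. (u, w) \<in> parcs B \<Longrightarrow> u \<notin> W"
    using acyclic_finite_source[OF acyclic_arcs finW] W ne by blast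
  then have pred: "direct_predecessors B w \<subseteq> ?D"
    using closed[of w] by (auto simp: direct_predecessors_def)
  then have occw: "occ (residual M k) (eq_of w) = {w}" using occ[OF w(1)] by blast
  have "self_contained (residual M k) {eq_of w}"
    using w W occw by (intro self_contained_subsetI[OF sc]) auto
  then have "S = {eq_of w}" using min[of "{eq_of w}"] w W by blast
  then show ?thesis using that w W pred occw by blast
qed

text \<open>Each step removes equations and variables in matched pairs, so the matching persists in
  every residual system.\<close>

lemma eqs_residual_eq: "eqs (residual M k) = eq_of ` (pverts B - determined_before M k)"
proof (induction k)
  case 0
  then show ?case by (simp add: eqs_eq determined_before_def)
next
  case (Suc k)
  let ?D = "determined_before M k"
  \<comment> \<open>\<open>W\<close> turns out to be exactly the set of variables determined at step
    \<open>k\<close>.\<close>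
  define W where "W = {w \<in> pverts B - ?D. {eq_of w} \<in> identified M k}"
  have single: "\<exists>w\<in>W. S = {eq_of w} \<and> determined_by M k S = {w}" if "S \<in> identified M k" for S
    using identified_singleton[OF Suc that] that
    by (metis (mono_tags, lifting) W_def determined_by_def mem_Collect_eq vars_of_singleton)
  have W: "determined_by M k {eq_of w} = {w}" if w: "w \<in> W" for w
  proof -
    obtain x where x: "x \<in> W" "{eq_of w} = {eq_of x}" "determined_by M k {eq_of w} = {x}"
      using w single[of "{eq_of w}"] unfolding W_def by blast
    then have "w = x" using w inj unfolding W_def inj_on_def by blast
    then show ?thesis using x by simp
  qed
  have "determined_before M (Suc k) = ?D \<union> (\<Union>S\<in>identified M k. determined_by M k S)"
    by (auto simp: determined_before_def lessThan_Suc)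
  also have "(\<Union>S\<in>identified M k. determined_by M k S) = W"
    using single W unfolding W_def by fastforce
  finally have D: "determined_before M (Suc k) = ?D \<union> W" .
  have "\<Union>(identified M k) = eq_of ` W"
    using single unfolding W_def by fastforce
  then have "eqs (residual M (Suc k)) = eq_of ` (pverts B - ?D) - eq_of ` W"
    using Suc by (simp add: solve_minimal_def identified_def)
  also have "\<dots> = eq_of ` (pverts B - ?D - W)"
    using inj_on_image_set_diff[OF inj, of "pverts B - ?D" W] by (auto simp: W_def)
  finally show ?case by (simp add: D Diff_Un Diff_eq Int_assoc)
qed

lemmas identified_cases = identified_singleton[OF eqs_residual_eq]

lemma causally_acyclic: "causally_acyclic M"
  unfolding causally_acyclic_def by (metis identified_cases is_singletonI is_singleton_altdef)

text \<open>The equation \<open>eq_of v\<close> determines \<open>v\<close> at a step by which all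
  predecessors of \<open>v\<close> in \<open>B\<close> are determined, and its other variables are
  just these predecessors.\<close>

lemma parcs_causal_graph: "parcs (causal_graph M) = parcs B"
proof (intro equalityI subrelI)
  fix u v assume "(u, v) \<in> parcs (causal_graph M)"
  then obtain k S where S: "S \<in> identified M k"
    and u: "u \<in> causal_predecessors M k S" and v: "v \<in> determined_by M k S"
    by (auto simp: causal_graph_def)
  obtain w where w: "w \<in> pverts B - determined_before M k" "S = {eq_of w}"
    "occ (residual M k) (eq_of w) = {w}"
    using identified_cases[OF S] .
  then show "(u, v) \<in> parcs B"
    using u v by (auto simp: causal_predecessors_def determined_by_def occ_eq_of
        direct_predecessors_def)
next
  fix u v assume uv: "(u, v) \<in> parcs B"
  then have "v \<in> pverts B" using arcs by blast
  then obtain k S where S: "S \<in> identified M k" "v \<in> determined_by M k S"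
    using every_variable_determined[OF model] verts by metis
  obtain w where w: "w \<in> pverts B - determined_before M k" "S = {eq_of w}"
    "occ (residual M k) (eq_of w) = {w}" "direct_predecessors B w \<subseteq> determined_before M k"
    using identified_cases[OF S(1)] .
  then have "w = v" using S by (simp add: determined_by_def)
  then have "u \<in> causal_predecessors M k S"
    using uv w by (auto simp: causal_predecessors_def occ_eq_of direct_predecessors_def)
  then show "(u, v) \<in> parcs (causal_graph M)"
    using S by (auto simp: causal_graph_def)
qed

lemma reflects: "reflects_causal_structure B M"
  unfolding reflects_causal_structure_def
  using causally_acyclic parcs_causal_graph verts
  by (auto simp: causal_graph_def intro: pair_pre_digraph.equality)

end

theorem theorem3:
  fixes B :: "'v pair_pre_digraph" and M :: "('e, 'v) equation_system"
  assumes "belief_network_graph B"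
    and "structural_model M"
    and "pverts B = vars_of M (eqs M)"
  shows "reflects_causal_structure B M \<longleftrightarrow>
    (\<exists>eq_of. inj_on eq_of (pverts B) \<and> eq_of ` pverts B \<subseteq> eqs M \<and>
       (\<forall>v\<in>pverts B. occ M (eq_of v) = insert v (direct_predecessors B v))) \<and>
    (\<forall>v\<in>pverts B. direct_predecessors B v = {} \<longrightarrow> exogenous M v)"
    (is "_ \<longleftrightarrow> ?mechanisms \<and> ?exogenous")
proof
  assume "reflects_causal_structure B M"
  then have acyc: "causally_acyclic M" and B: "causal_graph M = B"
    by (simp_all add: reflects_causal_structure_def)
  obtain eq_of where eq_of: "inj_on eq_of (pverts B)" "eq_of ` pverts B \<subseteq> eqs M"
    "\<And>v. v \<in> pverts B \<Longrightarrow> occ M (eq_of v) = insert v (direct_predecessors B v)"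
    using causally_acyclic_eq_of[OF assms(2) acyc] unfolding B assms(3) by metis
  \<comment> \<open>For a node without predecessors, \<open>eq_of v\<close> contains
    \<open>v\<close> alone and witnesses exogeneity.\<close>
  then have ?exogenous unfolding exogenous_def by fastforce
  then show "?mechanisms \<and> ?exogenous" using eq_of by blast
next
  assume "?mechanisms \<and> ?exogenous"
  then obtain eq_of where "inj_on eq_of (pverts B)" "eq_of ` pverts B \<subseteq> eqs M"
    "\<forall>v\<in>pverts B. occ M (eq_of v) = insert v (direct_predecessors B v)"
    by (elim conjE exE)
  moreover have "parcs B \<subseteq> pverts B \<times> pverts B" "acyclic (parcs B)"
  proof -
    interpret pair_fin_digraph B using assms(1) by (simp add: belief_network_graph_def)
    show "parcs B \<subseteq> pverts B \<times> pverts B" using in_arcsD1 in_arcsD2 by auto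
    show "acyclic (parcs B)" using assms(1) by (simp add: belief_network_graph_def)
  qed
  ultimately interpret matched_model M B eq_of
    using assms by unfold_locales auto
  show "reflects_causal_structure B M" by (rule reflects)
qed

end
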